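(* Let $N\ge 1$ and $n\ge 0$ be integers and let $y\in\mathbb{R}$. The Quasi-Hermite polynomial $z(x)=H_n(x,y;N)$ satisfies the third order ordinary differential equation $$\frac{y}{N}\,x\,z'''+y\left(2-\frac{n-2}{N}\right)z''+x\,z'=n\,z,$$ where primes denote derivatives with respect to $x$. As $N\to\infty$ (with $n$ and $y$ fixed), this equation tends, coefficient by coefficient, to the ordinary two-variable Hermite equation $2y\,z''+x\,z'=n\,z$.
   Context: For an integer $N\ge 1$, real $y$ and integer $n\ge 0$, the Quasi-Hermite polynomial is defined by $H_n(x,y;N)=\left(1+\frac{y}{N}\partial_x^2\right)^N x^n$, where $\partial_x$ is differentiation with respect to $x$. *)

theory Defs
  imports "HOL-Analysis.Analysis"
begin

definition one_plus_dxx :: "real \<Rightarrow> (real \<Rightarrow> real) \<Rightarrow> real \<Rightarrow> real" where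
  "one_plus_dxx c f = (\<lambda>x. f x + c * (deriv ^^ 2) f x)"

definition quasi_hermite :: "nat \<Rightarrow> real \<Rightarrow> real \<Rightarrow> nat \<Rightarrow> real" where
  "quasi_hermite n x y N = (one_plus_dxx (y / real N) ^^ N) (\<lambda>t. t ^ n) x"

text \<open>
  Linear equations of order \<open>m\<close> are written
  \<open>c m x z\<^sup>(\<^sup>m\<^sup>) + \<dots> + c 1 x z' = c 0 x z\<close>,
  so that \<open>c 0\<close> is the coefficient on the right-hand side. Since \<open>deriv\<close> is total,
  existence of the derivatives is required explicitly.
\<close>

definition solves_linear_ode :: "nat \<Rightarrow> (nat \<Rightarrow> real \<Rightarrow> real) \<Rightarrow> (real \<Rightarrow> real) \<Rightarrow> bool" where
  "solves_linear_ode m c z \<longleftrightarrow>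
     (\<forall>k<m. \<forall>x. (deriv ^^ k) z field_differentiable (at x)) \<and>
     (\<forall>x. (\<Sum>k=1..m. c k x * (deriv ^^ k) z x) = c 0 x * z x)"

definition quasi_hermite_ode_coeff :: "nat \<Rightarrow> real \<Rightarrow> nat \<Rightarrow> nat \<Rightarrow> real \<Rightarrow> real" where
  "quasi_hermite_ode_coeff n y N k x =
     (if k = 3 then y / real N * x
      else if k = 2 then y * (2 - (real n - 2) / real N)
      else if k = 1 then x
      else if k = 0 then real n
      else 0)"

text \<open>The Hermite equation \<open>2 y z'' + x z' = n z\<close> has order 2; its coefficients of
  higher order are zero.\<close>

definition hermite_ode_coeff :: "nat \<Rightarrow> real \<Rightarrow> nat \<Rightarrow> real \<Rightarrow> real" where
  "hermite_ode_coeff n y k x =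
     (if k = 2 then 2 * y
      else if k = 1 then x
      else if k = 0 then real n
      else 0)"

end

theory Submission
  imports Defs
begin

text \<open>
  Put \<open>A = 1 + c D\<^sup>2\<close> with \<open>c = y / N\<close>. From \<open>A x = x A + 2 c D\<close> one gets
  \<open>A\<^sup>N x D = x D A\<^sup>N + 2 c N D\<^sup>2 A\<^sup>N\<^sup>-\<^sup>1\<close>. Applied to \<open>x\<^sup>n\<close>, an eigenvector of
  \<open>x D\<close>, this says \<open>n z - x z' = 2 y D\<^sup>2 A\<^sup>N\<^sup>-\<^sup>1 x\<^sup>n\<close>. Applying \<open>A\<close> once more turns the
  right-hand side into \<open>2 y z''\<close>, which is the equation.
\<close>

text \<open>The polynomial counterpart of \<open>one_plus_dxx\<close>: on \<open>poly\<close> the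
  operator identities are purely algebraic and carry no differentiability side conditions.\<close>

definition poly_one_plus_dxx :: "'a::idom \<Rightarrow> 'a poly \<Rightarrow> 'a poly" where
  "poly_one_plus_dxx c p = p + smult c (pderiv (pderiv p))"

lemma poly_one_plus_dxx_add:
  "poly_one_plus_dxx c (p + q) = poly_one_plus_dxx c p + poly_one_plus_dxx c q"
  by (simp add: poly_one_plus_dxx_def pderiv_add smult_add_right)

lemma poly_one_plus_dxx_smult:
  "poly_one_plus_dxx c (smult a p) = smult a (poly_one_plus_dxx c p)"
  by (simp add: poly_one_plus_dxx_def pderiv_smult smult_add_right mult.commute)

lemma poly_one_plus_dxx_pderiv:
  "poly_one_plus_dxx c (pderiv p) = pderiv (poly_one_plus_dxx c p)"
  by (simp add: poly_one_plus_dxx_def pderiv_add pderiv_smult)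

lemma funpow_poly_one_plus_dxx_smult:
  "(poly_one_plus_dxx c ^^ N) (smult a p) = smult a ((poly_one_plus_dxx c ^^ N) p)"
  by (induction N) (simp_all add: poly_one_plus_dxx_smult)

text \<open>\<open>pCons 0 (pderiv p)\<close> is the Euler operator x D applied to p. The extra term
  comes from the commutator [D^2, x D] = 2 D^2.\<close>

lemma poly_one_plus_dxx_euler:
  "poly_one_plus_dxx c (pCons 0 (pderiv p)) =
     pCons 0 (pderiv (poly_one_plus_dxx c p)) + smult (2 * c) (pderiv (pderiv p))"
proof -
  \<comment> \<open>Leibniz rule for (x q)''; the instance of \<open>smult_add_left\<close> merges
    q' + q' into 2 q'.\<close>
  have *: "pderiv (pderiv (pCons 0 q)) = smult 2 (pderiv q) + pCons 0 (pderiv (pderiv q))"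
    for q :: "'a poly"
    using smult_add_left[of 1 1 "pderiv q"] by (simp add: pderiv_pCons pderiv_add)
  show ?thesis
    by (simp add: poly_one_plus_dxx_def * pderiv_add pderiv_smult smult_add_right mult.commute)
qed

text \<open>Moving x D past each factor A leaves one term 2 c D^2 in place of that factor. As A
  commutes with D, all these terms agree and only their number counts. The exponent
  \<open>Suc N\<close> avoids truncated subtraction.\<close>

lemma funpow_poly_one_plus_dxx_euler:
  "(poly_one_plus_dxx c ^^ Suc N) (pCons 0 (pderiv p)) =
     pCons 0 (pderiv ((poly_one_plus_dxx c ^^ Suc N) p))
     + smult (2 * c * of_nat (Suc N)) (pderiv (pderiv ((poly_one_plus_dxx c ^^ N) p)))"
proof (induction N)
  case 0
  show ?case by (simp add: poly_one_plus_dxx_euler)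
next
  case (Suc N)
  have "(poly_one_plus_dxx c ^^ Suc (Suc N)) (pCons 0 (pderiv p)) =
     poly_one_plus_dxx c ((poly_one_plus_dxx c ^^ Suc N) (pCons 0 (pderiv p)))"
    by simp
  also have "\<dots> = pCons 0 (pderiv ((poly_one_plus_dxx c ^^ Suc (Suc N)) p))
     + smult (2 * c) (pderiv (pderiv ((poly_one_plus_dxx c ^^ Suc N) p)))
     + smult (2 * c * of_nat (Suc N)) (pderiv (pderiv ((poly_one_plus_dxx c ^^ Suc N) p)))"
    unfolding Suc.IH
    by (simp add: poly_one_plus_dxx_add poly_one_plus_dxx_smult poly_one_plus_dxx_euler
        poly_one_plus_dxx_pderiv)
  also have "\<dots> = pCons 0 (pderiv ((poly_one_plus_dxx c ^^ Suc (Suc N)) p))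
     + smult (2 * c * of_nat (Suc (Suc N))) (pderiv (pderiv ((poly_one_plus_dxx c ^^ Suc N) p)))"
    by (simp add: smult_add_left[symmetric] algebra_simps del: funpow.simps)
  finally show ?case .
qed

lemma pCons_pderiv_monom: "pCons 0 (pderiv (monom 1 n)) = smult (of_nat n) (monom 1 n)"
  by (cases n) (simp_all add: pderiv_monom smult_monom flip: monom_Suc)

lemma poly_quasi_hermite_ode:
  fixes c :: "'a::idom"
  assumes "z = (poly_one_plus_dxx c ^^ N) (monom 1 n)" and "N \<ge> 1"
  shows "c * x * poly (pderiv (pderiv (pderiv z))) x
       + (2 * c * of_nat N + 2 * c - of_nat n * c) * poly (pderiv (pderiv z)) x
       + x * poly (pderiv z) x = of_nat n * poly z x"
proof -
  obtain M where N: "N = Suc M"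
    using assms(2) by (cases N) auto
  define w where "w = (poly_one_plus_dxx c ^^ M) (monom 1 n)"
  have zw: "z = poly_one_plus_dxx c w"
    by (simp add: assms(1) N w_def)
  have "smult (of_nat n) z = pCons 0 (pderiv z) + smult (2 * c * of_nat N) (pderiv (pderiv w))"
    using funpow_poly_one_plus_dxx_euler[of M c "monom 1 n"]
    unfolding pCons_pderiv_monom funpow_poly_one_plus_dxx_smult N[symmetric] assms(1)[symmetric]
      w_def[symmetric] .
  \<comment> \<open>Apply A to both sides: A w = z turns w'' into z'', and commuting A past x D
    contributes the additional 2 c z''.\<close>
  then have "smult (of_nat n) (poly_one_plus_dxx c z) =
      pCons 0 (pderiv (poly_one_plus_dxx c z)) + smult (2 * c) (pderiv (pderiv z))
      + smult (2 * c * of_nat N) (pderiv (pderiv z))"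
    by (metis poly_one_plus_dxx_add poly_one_plus_dxx_euler poly_one_plus_dxx_pderiv
        poly_one_plus_dxx_smult zw)
  then have "poly (smult (of_nat n) (poly_one_plus_dxx c z)) x =
      poly (pCons 0 (pderiv (poly_one_plus_dxx c z)) + smult (2 * c) (pderiv (pderiv z))
      + smult (2 * c * of_nat N) (pderiv (pderiv z))) x"
    by simp
  \<comment> \<open>Expanding A z = z + c z'' gives n c z'' on the left and c x z''' on the right;
    the former, moved across, is the summand -n c in the coefficient of z''.\<close>
  then show ?thesis
    by (simp add: poly_one_plus_dxx_def pderiv_add pderiv_smult algebra_simps)
qed

lemma deriv_poly: "deriv (poly p) = poly (pderiv p)"
  for p :: "'a::real_normed_field poly"
  by (intro ext DERIV_imp_deriv poly_DERIV)

lemma funpow_deriv_poly: "(deriv ^^ k) (poly p) = poly ((pderiv ^^ k) p)"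
  for p :: "'a::real_normed_field poly"
  by (induction k) (simp_all add: deriv_poly)

lemma one_plus_dxx_poly: "one_plus_dxx c (poly p) = poly (poly_one_plus_dxx c p)"
  by (rule ext)
    (simp add: one_plus_dxx_def poly_one_plus_dxx_def numeral_2_eq_2 deriv_poly)

lemma quasi_hermite_eq_poly:
  "(\<lambda>x. quasi_hermite n x y N) = poly ((poly_one_plus_dxx (y / real N) ^^ N) (monom 1 n))"
proof -
  have "(one_plus_dxx c ^^ k) (poly p) = poly ((poly_one_plus_dxx c ^^ k) p)" for c k p
    by (induction k) (simp_all add: one_plus_dxx_poly)
  moreover have "(\<lambda>t::real. t ^ n) = poly (monom 1 n)"
    by (simp add: poly_monom fun_eq_iff)
  ultimately show ?thesis
    by (simp add: quasi_hermite_def fun_eq_iff)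
qed

lemma quasi_hermite_solves_ode:
  assumes "N \<ge> 1"
  shows "solves_linear_ode 3 (quasi_hermite_ode_coeff n y N) (\<lambda>x. quasi_hermite n x y N)"
proof -
  define z where "z = (poly_one_plus_dxx (y / real N) ^^ N) (monom 1 n)"
  \<comment> \<open>With c = y / N one has y = c N, which uses N \<noteq> 0.\<close>
  have coeff2: "y * (2 - (real n - 2) / real N)
      = 2 * (y / real N) * real N + 2 * (y / real N) - real n * (y / real N)"
    using assms by (simp add: field_simps)
  have "{1..3} = {1, 2, 3 :: nat}"
    by auto
  then have "(\<Sum>k=1..3. quasi_hermite_ode_coeff n y N k x * poly ((pderiv ^^ k) z) x)
      = y / real N * x * poly (pderiv (pderiv (pderiv z))) x
        + y * (2 - (real n - 2) / real N) * poly (pderiv (pderiv z)) x + x * poly (pderiv z) x" for x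
    by (simp add: quasi_hermite_ode_coeff_def eval_nat_numeral)
  then have "(\<Sum>k=1..3. quasi_hermite_ode_coeff n y N k x * poly ((pderiv ^^ k) z) x)
      = quasi_hermite_ode_coeff n y N 0 x * poly z x" for x
    unfolding coeff2 poly_quasi_hermite_ode[OF z_def assms]
    by (simp add: quasi_hermite_ode_coeff_def)
  \<comment> \<open>All iterated derivatives of z are again polynomials, so this settles the
    existence clause of \<open>solves_linear_ode\<close>.\<close>
  moreover have "poly p field_differentiable at x" for p :: "real poly" and x
    using poly_DERIV field_differentiable_def by blast
  ultimately show ?thesis
    by (simp add: solves_linear_ode_def quasi_hermite_eq_poly funpow_deriv_poly flip: z_def)
qed

lemma quasi_hermite_ode_coeff_tendsto:
  "(\<lambda>N. quasi_hermite_ode_coeff n y N k x) \<longlonglongrightarrow> hermite_ode_coeff n y k x"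
proof -
  \<comment> \<open>Only the coefficients with k = 3 and k = 2 vary with N; the others are constant
    and already equal to their limits.\<close>
  have "(\<lambda>N. y / real N * x) \<longlonglongrightarrow> 0 * x"
    by (intro tendsto_intros lim_const_over_n)
  moreover have "(\<lambda>N. y * (2 - (real n - 2) / real N)) \<longlonglongrightarrow> y * (2 - 0)"
    by (intro tendsto_intros lim_const_over_n)
  ultimately show ?thesis
    by (cases "k = 3"; cases "k = 2")
      (simp_all add: quasi_hermite_ode_coeff_def hermite_ode_coeff_def mult.commute)
qed

theorem corollary3:
  fixes n :: nat and y :: real
  shows "(\<forall>N\<ge>1. solves_linear_ode 3 (quasi_hermite_ode_coeff n y N) (\<lambda>x. quasi_hermite n x y N)) \<and>
         (\<forall>k x. (\<lambda>N. quasi_hermite_ode_coeff n y N k x) \<longlonglongrightarrow> hermite_ode_coeff n y k x)"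
  using quasi_hermite_solves_ode quasi_hermite_ode_coeff_tendsto by blast

end
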